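(* For every $\alpha\in\mathbb R^{G\times D}$ and $\beta_{1:M}=(\beta_1,\ldots,\beta_M)$ with $\beta_j\in\mathbb R^G$, the power balance condition $$1_G^\top\hat x_{\alpha,\beta_{1:M}}(\xi,t)=1_D^\top\xi(t)\quad\forall(\xi,t)\in\Omega\times\mathcal T$$ holds if and only if $$1_G^\top\alpha=1_D^\top\quad\text{and}\quad 1_G^\top\beta_j=0\quad\forall j\in\mathbb N[M].$$
   Context: Notation: $\mathbb N[n]:=\{1,\ldots,n\}$; $1_n$ is the $n$-dimensional all-ones vector; $G,D$ are positive integers (numbers of generators and loads); $T\in(0,\infty)$, $\mathcal T:=[0,T]$; $\mathcal C_n$ is the set of continuous functions $\mathcal T\to\mathbb R^n$; $\mathcal T^{\rm o}:=\{(t_1,t_2)\in\mathcal T^2:t_1<t_2\}$. Demand data: for each $d\in\mathbb N[D]$, $\Xi_d$ is a given set, with at least two elements, of functions $\xi_d:\mathcal T\to\mathbb R$. With $R(\xi_d,t_1,t_2):=(\xi_d(t_2)-\xi_d(t_1))/(t_2-t_1)$, it is assumed that $\overline r_d:=\sup\{R(\xi_d,t_1,t_2):\xi_d\in\Xi_d,(t_1,t_2)\in\mathcal T^{\rm o}\}<\infty$ and $\underline r_d:=\inf\{R(\xi_d,t_1,t_2):\xi_d\in\Xi_d,(t_1,t_2)\in\mathcal T^{\rm o}\}>-\infty$. Superset $\Omega$: fix an integer $N\ge2$ and equally spaced points $0=T_1<T_2<\cdots<T_N=T$. Let $i(t):=j$ if $t\in[T_j,T_{j+1})$ and $i(T):=N-1$.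 Let $\overline\omega'_d(t):=\sup\{\xi_d(\tau):\xi_d\in\Xi_d,\tau\in[T_{i(t)},T_{i(t)+1}]\}$ and $\underline\omega'_d(t):=\inf\{\xi_d(\tau):\xi_d\in\Xi_d,\tau\in[T_{i(t)},T_{i(t)+1}]\}$, assumed finite. Let $$\Omega_d:=\{\xi_d\in\mathcal C_1:\underline\omega'_d(t)\le\xi_d(t)\le\overline\omega'_d(t)\ \forall t\in\mathcal T,\ \underline r_d\le R(\xi_d,t_1,t_2)\le\overline r_d\ \forall(t_1,t_2)\in\mathcal T^{\rm o}\},\quad \Omega:=\Omega_1\times\cdots\times\Omega_D\subset\mathcal C_D.$$ (Thus $\Xi_1\times\cdots\times\Xi_D\subseteq\Omega$.) Breakpoints (convention $0/0=0$): for $j\in\mathbb N[N-2]$ let $\overline\omega'^{+}_{d,j}:=\overline\omega'_d(T_{j+1})-\overline\omega'_d(T_j)$ and $\underline\omega'^{+}_{d,j}:=\underline\omega'_d(T_{j+1})-\underline\omega'_d(T_j)$. Let $\overline T^{\rm b}_{d,j}:=T_{j+1}+\overline\omega'^{+}_{d,j}/\overline r_d$ if $\overline\omega'^{+}_{d,j}\ge0$, and $T_{j+1}-\overline\omega'^{+}_{d,j}/\underline r_d$ otherwise. Let $\underline T^{\rm b}_{d,j}:=T_{j+1}-\underline\omega'^{+}_{d,j}/\overline r_d$ if $\underline\omega'^{+}_{d,j}\ge0$, and $T_{j+1}+\underline\omega'^{+}_{d,j}/\underline r_d$ otherwise. Let $\overline{\mathcal T}^{\rm b}_d:=\{T_1,\ldots,T_N\}\cup\{\overline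 T^{\rm b}_{d,1},\ldots,\overline T^{\rm b}_{d,N-2}\}$ and $\underline{\mathcal T}^{\rm b}_d:=\{T_1,\ldots,T_N\}\cup\{\underline T^{\rm b}_{d,1},\ldots,\underline T^{\rm b}_{d,N-2}\}$; all these points lie in $[0,T]$. Decision rule: let $\mathcal T^{\rm b}:=\bigcup_{d\in\mathbb N[D]}(\overline{\mathcal T}^{\rm b}_d\cup\underline{\mathcal T}^{\rm b}_d)=\{T^{\rm b}_1,\ldots,T^{\rm b}_M\}$ with $0=T^{\rm b}_1<\cdots<T^{\rm b}_M=T$, $M=|\mathcal T^{\rm b}|$, and $\Delta^{\rm b}_j:=T^{\rm b}_{j+1}-T^{\rm b}_j$. Let $k(t):=j$ if $t\in[T^{\rm b}_j,T^{\rm b}_{j+1})$, $k(T):=M-1$; $\gamma(t):=(t-T^{\rm b}_{k(t)})/\Delta^{\rm b}_{k(t)}$ for $t\in[0,T)$, $\gamma(T):=1$. For $\alpha\in\mathbb R^{G\times D}$ and $\beta_1,\ldots,\beta_M\in\mathbb R^G$, and $\xi\in\Omega$, $t\in\mathcal T$, $$\hat x_{\alpha,\beta_{1:M}}(\xi,t):=\alpha\xi(t)+(1-\gamma(t))\beta_{k(t)}+\gamma(t)\beta_{k(t)+1}\in\mathbb R^G.$$ *)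

theory Defs
  imports "HOL-Analysis.Analysis"
begin

text \<open>
  The time horizon is the interval \<open>{0..T}\<close>. A function defined on it only is represented by an
  element of \<^const>\<open>extensional\<close> \<open>{0..T}\<close>, so that equality of such functions is equality on the
  horizon. Loads and generators are indexed by finite types \<open>'d\<close> and \<open>'g\<close>.
\<close>

definition cont_funs :: "real \<Rightarrow> (real \<Rightarrow> 'b::topological_space) set" where
  "cont_funs T = {f \<in> extensional {0..T}. continuous_on {0..T} f}"

definition time_pairs :: "real \<Rightarrow> (real \<times> real) set" where
  "time_pairs T = {(t1, t2). t1 \<in> {0..T} \<and> t2 \<in> {0..T} \<and> t1 < t2}"

definition ramp :: "(real \<Rightarrow> real) \<Rightarrow> real \<Rightarrow> real \<Rightarrow> real" where
  "ramp f t1 t2 = (f t2 - f t1) / (t2 - t1)"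

text \<open>
  In the definitions below, \<open>X\<close> is the demand set of one load. Suprema and infima are taken in
  \<^typ>\<open>real\<close>, hence are meaningful only where the underlying set is nonempty and bounded.
\<close>

definition ramps :: "real \<Rightarrow> (real \<Rightarrow> real) set \<Rightarrow> real set" where
  "ramps T X = {ramp f t1 t2 | f t1 t2. f \<in> X \<and> (t1, t2) \<in> time_pairs T}"

definition r_up :: "real \<Rightarrow> (real \<Rightarrow> real) set \<Rightarrow> real" where
  "r_up T X = Sup (ramps T X)"

definition r_lo :: "real \<Rightarrow> (real \<Rightarrow> real) set \<Rightarrow> real" where
  "r_lo T X = Inf (ramps T X)"

text \<open>The \<open>N\<close> equally spaced points with indices \<open>1, \<dots>, N\<close>, from \<open>0\<close> to \<open>T\<close>.\<close>

definition grid :: "real \<Rightarrow> nat \<Rightarrow> nat \<Rightarrow> real" where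
  "grid T N j = (real j - 1) * T / (real N - 1)"

definition grid_idx :: "real \<Rightarrow> nat \<Rightarrow> real \<Rightarrow> nat" where
  "grid_idx T N t =
     (if t = T then N - 1
      else (THE j. j \<in> {1..N - 1} \<and> t \<in> {grid T N j..<grid T N (j + 1)}))"

definition window_values :: "real \<Rightarrow> nat \<Rightarrow> (real \<Rightarrow> real) set \<Rightarrow> real \<Rightarrow> real set" where
  "window_values T N X t =
     {f \<tau> | f \<tau>. f \<in> X \<and> \<tau> \<in> {grid T N (grid_idx T N t)..grid T N (grid_idx T N t + 1)}}"

definition omega_up :: "real \<Rightarrow> nat \<Rightarrow> (real \<Rightarrow> real) set \<Rightarrow> real \<Rightarrow> real" where
  "omega_up T N X t = Sup (window_values T N X t)"

definition omega_lo :: "real \<Rightarrow> nat \<Rightarrow> (real \<Rightarrow> real) set \<Rightarrow> real \<Rightarrow> real" where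
  "omega_lo T N X t = Inf (window_values T N X t)"

definition Omega_load :: "real \<Rightarrow> nat \<Rightarrow> (real \<Rightarrow> real) set \<Rightarrow> (real \<Rightarrow> real) set" where
  "Omega_load T N X =
     {f \<in> cont_funs T.
        (\<forall>t\<in>{0..T}. omega_lo T N X t \<le> f t \<and> f t \<le> omega_up T N X t) \<and>
        (\<forall>(t1, t2)\<in>time_pairs T. r_lo T X \<le> ramp f t1 t2 \<and> ramp f t1 t2 \<le> r_up T X)}"

text \<open>The product of the sets of the individual loads, as a set of vector-valued functions.\<close>

definition Omega ::
  "real \<Rightarrow> nat \<Rightarrow> ('d::finite \<Rightarrow> (real \<Rightarrow> real) set) \<Rightarrow> (real \<Rightarrow> real ^ 'd) set" where
  "Omega T N \<Xi> =
     {\<xi> \<in> cont_funs T. \<forall>d. (\<lambda>t\<in>{0..T}. \<xi> t $ d) \<in> Omega_load T N (\<Xi> d)}"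

definition omega_up_inc :: "real \<Rightarrow> nat \<Rightarrow> (real \<Rightarrow> real) set \<Rightarrow> nat \<Rightarrow> real" where
  "omega_up_inc T N X j = omega_up T N X (grid T N (j + 1)) - omega_up T N X (grid T N j)"

definition omega_lo_inc :: "real \<Rightarrow> nat \<Rightarrow> (real \<Rightarrow> real) set \<Rightarrow> nat \<Rightarrow> real" where
  "omega_lo_inc T N X j = omega_lo T N X (grid T N (j + 1)) - omega_lo T N X (grid T N j)"

text \<open>The convention \<open>0 / 0 = 0\<close> used here is the one of \<^typ>\<open>real\<close>.\<close>

definition break_up :: "real \<Rightarrow> nat \<Rightarrow> (real \<Rightarrow> real) set \<Rightarrow> nat \<Rightarrow> real" where
  "break_up T N X j =
     (if omega_up_inc T N X j \<ge> 0
      then grid T N (j + 1) + omega_up_inc T N X j / r_up T X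
      else grid T N (j + 1) - omega_up_inc T N X j / r_lo T X)"

definition break_lo :: "real \<Rightarrow> nat \<Rightarrow> (real \<Rightarrow> real) set \<Rightarrow> nat \<Rightarrow> real" where
  "break_lo T N X j =
     (if omega_lo_inc T N X j \<ge> 0
      then grid T N (j + 1) - omega_lo_inc T N X j / r_up T X
      else grid T N (j + 1) + omega_lo_inc T N X j / r_lo T X)"

definition breaks_up :: "real \<Rightarrow> nat \<Rightarrow> (real \<Rightarrow> real) set \<Rightarrow> real set" where
  "breaks_up T N X = grid T N ` {1..N} \<union> break_up T N X ` {1..N - 2}"

definition breaks_lo :: "real \<Rightarrow> nat \<Rightarrow> (real \<Rightarrow> real) set \<Rightarrow> real set" where
  "breaks_lo T N X = grid T N ` {1..N} \<union> break_lo T N X ` {1..N - 2}"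

definition breaks :: "real \<Rightarrow> nat \<Rightarrow> ('d::finite \<Rightarrow> (real \<Rightarrow> real) set) \<Rightarrow> real set" where
  "breaks T N \<Xi> = (\<Union>d. breaks_up T N (\<Xi> d) \<union> breaks_lo T N (\<Xi> d))"

definition num_breaks :: "real \<Rightarrow> nat \<Rightarrow> ('d::finite \<Rightarrow> (real \<Rightarrow> real) set) \<Rightarrow> nat" where
  "num_breaks T N \<Xi> = card (breaks T N \<Xi>)"

text \<open>The breakpoints in increasing order, with indices starting at \<open>1\<close>.\<close>

definition Tb :: "real \<Rightarrow> nat \<Rightarrow> ('d::finite \<Rightarrow> (real \<Rightarrow> real) set) \<Rightarrow> nat \<Rightarrow> real" where
  "Tb T N \<Xi> j = sorted_list_of_set (breaks T N \<Xi>) ! (j - 1)"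

definition Tb_width :: "real \<Rightarrow> nat \<Rightarrow> ('d::finite \<Rightarrow> (real \<Rightarrow> real) set) \<Rightarrow> nat \<Rightarrow> real" where
  "Tb_width T N \<Xi> j = Tb T N \<Xi> (j + 1) - Tb T N \<Xi> j"

definition Tb_idx :: "real \<Rightarrow> nat \<Rightarrow> ('d::finite \<Rightarrow> (real \<Rightarrow> real) set) \<Rightarrow> real \<Rightarrow> nat" where
  "Tb_idx T N \<Xi> t =
     (if t = T then num_breaks T N \<Xi> - 1
      else (THE j. j \<in> {1..num_breaks T N \<Xi> - 1} \<and> t \<in> {Tb T N \<Xi> j..<Tb T N \<Xi> (j + 1)}))"

definition gam :: "real \<Rightarrow> nat \<Rightarrow> ('d::finite \<Rightarrow> (real \<Rightarrow> real) set) \<Rightarrow> real \<Rightarrow> real" where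
  "gam T N \<Xi> t =
     (if t = T then 1
      else (t - Tb T N \<Xi> (Tb_idx T N \<Xi> t)) / Tb_width T N \<Xi> (Tb_idx T N \<Xi> t))"

text \<open>Only the values of \<open>\<beta>\<close> at \<open>1, \<dots>, num_breaks T N \<Xi>\<close> are relevant.\<close>

definition xhat ::
  "real \<Rightarrow> nat \<Rightarrow> ('d::finite \<Rightarrow> (real \<Rightarrow> real) set) \<Rightarrow> real ^ 'd ^ 'g::finite \<Rightarrow>
   (nat \<Rightarrow> real ^ 'g) \<Rightarrow> (real \<Rightarrow> real ^ 'd) \<Rightarrow> real \<Rightarrow> real ^ 'g" where
  "xhat T N \<Xi> \<alpha> \<beta> \<xi> t =
     \<alpha> *v \<xi> t + (1 - gam T N \<Xi> t) *\<^sub>R \<beta> (Tb_idx T N \<Xi> t)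
       + gam T N \<Xi> t *\<^sub>R \<beta> (Tb_idx T N \<Xi> t + 1)"

end

theory Submission
  imports Defs
begin

text \<open>
  Apply the all-ones functional \<open>1 \<bullet> _\<close> to the decision rule: with \<open>c = 1 v* \<alpha> - 1\<close>, power balance
  at \<open>(\<xi>, t)\<close> says that \<open>c \<bullet> \<xi> t\<close> plus the piecewise linear interpolation, at \<open>t\<close>, of the numbers
  \<open>1 \<bullet> \<beta> j\<close> vanishes. Sufficiency is then immediate, provided that the interpolation really uses
  indices in \<open>{1..num_breaks T N \<Xi>}\<close>.

  For necessity, only the inclusion of the product of the demand sets in \<open>\<Omega>\<close> matters (lemma
  \<open>bundle_in_Omega\<close>). Two distinct demand functions of load \<open>d\<close> differ at some time \<open>t\<close>. Placing
  each of them in component \<open>d\<close>, with the other components equal, and subtracting the two balance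
  equations at \<open>t\<close> cancels the interpolation and leaves \<open>c $ d = 0\<close>. Once \<open>c = 0\<close>, the interpolation
  vanishes on the whole horizon, and its value at the \<open>j\<close>-th breakpoint is \<open>1 \<bullet> \<beta> j\<close>.

  Both directions need that the breakpoints start at \<open>0\<close> and end at \<open>T\<close>, so that every time
  lies in a cell between consecutive breakpoints. This is the one quantitative point (lemma
  \<open>breaks_subset_horizon\<close>): the ramp bounds control how much the suprema and infima change from one
  window to the next, so that a breakpoint stays within one grid step of the grid point from which
  it is displaced.
\<close>

section \<open>Cells of a partition\<close>

lemma ex1_cell:
  fixes p :: "nat \<Rightarrow> 'a::linorder"
  assumes mono: "strict_mono_on {1..n} p" and lo: "p 1 \<le> t" and hi: "t < p n" and n: "1 \<le> n"
  shows "\<exists>!j. j \<in> {1..n - 1} \<and> t \<in> {p j..<p (j + 1)}"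
proof -
  define S where "S = {j \<in> {1..n}. p j \<le> t}"
  have fin: "finite S" and "1 \<in> S"
    using lo n by (auto simp: S_def)
  then have "Max S \<in> S" using Max_in by blast
  then have m: "1 \<le> Max S" "Max S \<le> n" "p (Max S) \<le> t" by (auto simp: S_def)
  with hi have "Max S \<noteq> n" by auto
  with m have lt: "Max S < n" by simp
  have "Max S + 1 \<notin> S" using Max_ge[OF fin, of "Max S + 1"] by auto
  with lt have "t < p (Max S + 1)" by (auto simp: S_def)
  with m lt have ex: "Max S \<in> {1..n - 1} \<and> t \<in> {p (Max S)..<p (Max S + 1)}" by auto
  have no_overlap: False
    if "i \<in> {1..n - 1}" "t \<in> {p i..<p (i + 1)}" "j \<in> {1..n - 1}" "t \<in> {p j..<p (j + 1)}" "i < j"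
    for i j
  proof -
    have "p (i + 1) \<le> p j"
    proof (cases "i + 1 = j")
      case False
      with that show ?thesis by (intro less_imp_le strict_mono_onD[OF mono]) auto
    qed simp
    with that show False by auto
  qed
  show ?thesis
  proof (rule ex1I)
    show "Max S \<in> {1..n - 1} \<and> t \<in> {p (Max S)..<p (Max S + 1)}" by (rule ex)
  next
    fix j assume "j \<in> {1..n - 1} \<and> t \<in> {p j..<p (j + 1)}"
    then show "j = Max S" using no_overlap[of j "Max S"] no_overlap[of "Max S" j] ex
      by (metis linorder_neqE_nat)
  qed
qed

section \<open>The demand set of one load\<close>

text \<open>
  For \<open>r = 0\<close> the hypotheses force \<open>x = 0\<close>, and \<open>0 / 0 = 0\<close> lies in the segment: this is where the
  convention for breakpoints with a vanishing ramp bound is used.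
\<close>

lemma divide_in_segment:
  fixes x r s :: real
  assumes "0 \<le> x" "x \<le> r * s" "0 < s"
  shows "x / r \<in> {0..s}"
proof -
  have "0 \<le> r * s" using assms by linarith
  then have "0 \<le> r" using assms(3) by (simp add: zero_le_mult_iff)
  then show ?thesis using assms
    by (cases "r = 0") (auto simp: pos_divide_le_eq mult.commute)
qed

locale load =
  fixes T :: real and N :: nat and X :: "(real \<Rightarrow> real) set"
  assumes T_pos: "T > 0" and N_ge_2: "N \<ge> 2"
    and demand_extensional: "X \<subseteq> extensional {0..T}"
    and demand_nonempty: "X \<noteq> {}"
    and ramps_above: "bdd_above (ramps T X)" and ramps_below: "bdd_below (ramps T X)"
    and window_above: "t \<in> {0..T} \<Longrightarrow> bdd_above (window_values T N X t)"
    and window_below: "t \<in> {0..T} \<Longrightarrow> bdd_below (window_values T N X t)"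
begin

subsection \<open>The grid\<close>

abbreviation \<open>step \<equiv> T / (real N - 1)\<close>

lemma step_pos: "step > 0"
  using T_pos N_ge_2 by simp

lemma grid_1: "grid T N 1 = 0" and grid_N: "grid T N N = T"
  using N_ge_2 by (auto simp: grid_def)

lemma grid_Suc: "grid T N (j + 1) = grid T N j + step"
  by (simp add: grid_def field_simps add_divide_distrib diff_divide_distrib)

lemma grid_strict_mono: "strict_mono (grid T N)"
  using step_pos grid_Suc by (auto simp: strict_mono_Suc_iff)

lemma grid_in_horizon: "j \<in> {1..N} \<Longrightarrow> grid T N j \<in> {0..T}"
  using strict_mono_less_eq[OF grid_strict_mono, of 1 j]
    strict_mono_less_eq[OF grid_strict_mono, of j N] grid_1 grid_N by auto

lemma ex1_grid_cell:
  assumes "t \<in> {0..<T}"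
  shows "\<exists>!j. j \<in> {1..N - 1} \<and> t \<in> {grid T N j..<grid T N (j + 1)}"
  using assms N_ge_2 grid_1 grid_N
  by (intro ex1_cell) (auto intro: monotone_on_subset[OF grid_strict_mono])

lemma grid_idx_window:
  assumes "t \<in> {0..T}"
  shows "t \<in> {grid T N (grid_idx T N t)..grid T N (grid_idx T N t + 1)}"
proof (cases "t = T")
  case True
  have "grid T N (N - 1) \<le> T"
    using strict_mono_less_eq[OF grid_strict_mono, of "N - 1" N] grid_N by simp
  with True show ?thesis using N_ge_2 grid_N by (simp add: grid_idx_def)
next
  case False
  with assms have "t \<in> {0..<T}" by auto
  from theI'[OF ex1_grid_cell[OF this]] False show ?thesis
    by (auto simp: grid_idx_def)
qed

lemma grid_idx_grid:
  assumes "j \<in> {1..N - 1}"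
  shows "grid_idx T N (grid T N j) = j"
proof -
  have lt: "grid T N j < grid T N N" "grid T N j < grid T N (j + 1)"
    using assms strict_mono_less[OF grid_strict_mono] by auto
  with assms grid_in_horizon[of j] have "grid T N j \<in> {0..<T}" by (auto simp: grid_N)
  from the1_equality[OF ex1_grid_cell[OF this]] assms lt show ?thesis
    by (auto simp: grid_idx_def grid_N)
qed

lemma window_values_grid:
  assumes "j \<in> {1..N - 1}"
  shows "window_values T N X (grid T N j)
    = {f \<tau> | f \<tau>. f \<in> X \<and> \<tau> \<in> {grid T N j..grid T N (j + 1)}}"
  by (simp add: window_values_def grid_idx_grid[OF assms])

subsection \<open>The demand set is contained in its superset\<close>

lemma ramp_bounds:
  assumes "f \<in> X" "(t1, t2) \<in> time_pairs T"
  shows "r_lo T X \<le> ramp f t1 t2" "ramp f t1 t2 \<le> r_up T X"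
proof -
  have "ramp f t1 t2 \<in> ramps T X" using assms by (auto simp: ramps_def)
  then show "r_lo T X \<le> ramp f t1 t2" "ramp f t1 t2 \<le> r_up T X"
    unfolding r_lo_def r_up_def
    using ramps_above ramps_below by (auto intro: cInf_lower cSup_upper)
qed

lemma increment_bounds:
  assumes "f \<in> X" "t1 \<in> {0..T}" "t2 \<in> {0..T}" "t1 < t2"
  shows "r_lo T X * (t2 - t1) \<le> f t2 - f t1" "f t2 - f t1 \<le> r_up T X * (t2 - t1)"
  using ramp_bounds[of f t1 t2] assms by (auto simp: time_pairs_def ramp_def field_simps)

lemma demand_continuous:
  assumes "f \<in> X"
  shows "continuous_on {0..T} f"
proof -
  define L where "L = max \<bar>r_lo T X\<bar> \<bar>r_up T X\<bar>"
  have aux: "\<bar>f t2 - f t1\<bar> \<le> L * \<bar>t2 - t1\<bar>"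
    if "t1 \<in> {0..T}" "t2 \<in> {0..T}" "t1 < t2" for t1 t2
  proof -
    have "r_up T X * (t2 - t1) \<le> L * (t2 - t1)" "- L * (t2 - t1) \<le> r_lo T X * (t2 - t1)"
      using that unfolding L_def by (intro mult_right_mono; simp)+
    with increment_bounds[OF assms that] have "\<bar>f t2 - f t1\<bar> \<le> L * (t2 - t1)" by linarith
    with that show ?thesis by simp
  qed
  have "L-lipschitz_on {0..T} f"
  proof (rule lipschitz_onI)
    fix x y assume "x \<in> {0..T}" "y \<in> {0..T}"
    then show "dist (f x) (f y) \<le> L * dist x y"
      using aux[of x y] aux[of y x]
      by (cases x y rule: linorder_cases) (auto simp: dist_real_def abs_minus_commute)
  qed (simp add: L_def)
  then show ?thesis by (rule lipschitz_on_continuous_on)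
qed

text \<open>
  The window bounds and ramp bounds hold by definition of supremum and infimum. Continuity is
  a consequence of the ramp bounds, which make every demand function Lipschitz.
\<close>

lemma demand_subset_Omega_load: "X \<subseteq> Omega_load T N X"
proof
  fix f assume f: "f \<in> X"
  have "omega_lo T N X t \<le> f t \<and> f t \<le> omega_up T N X t" if "t \<in> {0..T}" for t
  proof -
    have "f t \<in> window_values T N X t"
      using f grid_idx_window[OF that] unfolding window_values_def by blast
    then show ?thesis
      unfolding omega_lo_def omega_up_def
      using window_above[OF that] window_below[OF that] by (auto intro: cInf_lower cSup_upper)
  qed
  then show "f \<in> Omega_load T N X"
    using f demand_extensional demand_continuous ramp_bounds
    by (auto simp: Omega_load_def cont_funs_def)
qed

subsection \<open>The breakpoints lie in the horizon\<close>

text \<open>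
  Translation by one step maps a window onto the next one and changes every demand function by an
  amount between the ramp bounds times the step. Suprema and infima inherit these bounds.
\<close>

lemma window_increments:
  assumes j: "j \<in> {1..N - 2}"
  shows "r_lo T X * step \<le> omega_up_inc T N X j" "omega_up_inc T N X j \<le> r_up T X * step"
    and "r_lo T X * step \<le> omega_lo_inc T N X j" "omega_lo_inc T N X j \<le> r_up T X * step"
proof -
  let ?a = "grid T N j" and ?W = "\<lambda>j. window_values T N X (grid T N j)"
  have jN: "j \<in> {1..N - 1}" "j + 1 \<in> {1..N - 1}" "j \<in> {1..N}" "j + 1 + 1 \<in> {1..N}" "j + 1 \<in> {1..N}"
    using j N_ge_2 by auto
  have W: "?W j = {f \<tau> | f \<tau>. f \<in> X \<and> \<tau> \<in> {?a..?a + step}}"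
    "?W (j + 1) = {f (\<tau> + step) | f \<tau>. f \<in> X \<and> \<tau> \<in> {?a..?a + step}}"
  proof -
    show "?W j = {f \<tau> | f \<tau>. f \<in> X \<and> \<tau> \<in> {?a..?a + step}}"
      unfolding window_values_grid[OF jN(1)] by (simp only: grid_Suc)
    have "?W (j + 1) = {f \<tau> | f \<tau>. f \<in> X \<and> \<tau> \<in> {?a + step..?a + step + step}}"
      unfolding window_values_grid[OF jN(2)] by (simp only: grid_Suc)
    also have "\<dots> = {f (\<tau> + step) | f \<tau>. f \<in> X \<and> \<tau> \<in> {?a..?a + step}}" (is "?L = ?R")
    proof (intro set_eqI iffI)
      fix y assume "y \<in> ?L"
      then obtain f \<tau> where f: "y = f \<tau>" "f \<in> X" "\<tau> \<in> {?a + step..?a + step + step}" by blast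
      then have "y = f (\<tau> - step + step)" "\<tau> - step \<in> {?a..?a + step}" by auto
      with f(2) show "y \<in> ?R" by blast
    next
      fix y assume "y \<in> ?R"
      then obtain f \<tau> where f: "y = f (\<tau> + step)" "f \<in> X" "\<tau> \<in> {?a..?a + step}" by blast
      then have "\<tau> + step \<in> {?a + step..?a + step + step}" by auto
      with f(1,2) show "y \<in> ?L" by blast
    qed
    finally show "?W (j + 1) = ?R" .
  qed
  have hor: "?a \<in> {0..T}" "grid T N (j + 1) \<in> {0..T}" "?a + step + step \<in> {0..T}"
    using grid_in_horizon jN(3-5) grid_Suc by metis+
  have shift: "r_lo T X * step \<le> f (\<tau> + step) - f \<tau>" "f (\<tau> + step) - f \<tau> \<le> r_up T X * step"
    if "f \<in> X" "\<tau> \<in> {?a..?a + step}" for f \<tau>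
  proof -
    have "\<tau> \<in> {0..T}" "\<tau> + step \<in> {0..T}" "\<tau> < \<tau> + step"
      using that(2) hor step_pos by auto
    from increment_bounds[OF that(1) this]
    show "r_lo T X * step \<le> f (\<tau> + step) - f \<tau>" "f (\<tau> + step) - f \<tau> \<le> r_up T X * step"
      by simp_all
  qed
  have bounds: "Inf (?W j) \<le> f \<tau>" "f \<tau> \<le> Sup (?W j)"
      "Inf (?W (j + 1)) \<le> f (\<tau> + step)" "f (\<tau> + step) \<le> Sup (?W (j + 1))"
    if "f \<in> X" "\<tau> \<in> {?a..?a + step}" for f \<tau>
  proof -
    have "f \<tau> \<in> ?W j" "f (\<tau> + step) \<in> ?W (j + 1)" unfolding W using that by blast+
    then show "Inf (?W j) \<le> f \<tau>" "f \<tau> \<le> Sup (?W j)"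
      "Inf (?W (j + 1)) \<le> f (\<tau> + step)" "f (\<tau> + step) \<le> Sup (?W (j + 1))"
      using window_above[OF hor(1)] window_below[OF hor(1)]
        window_above[OF hor(2)] window_below[OF hor(2)]
      by (auto intro: cInf_lower cSup_upper)
  qed
  obtain f where f: "f \<in> X" using demand_nonempty by blast
  have ne: "?W j \<noteq> {}" "?W (j + 1) \<noteq> {}"
  proof -
    have "?a \<in> {?a..?a + step}" using step_pos by simp
    then show "?W j \<noteq> {}" "?W (j + 1) \<noteq> {}" unfolding W using f by blast+
  qed
  have "Sup (?W (j + 1)) \<le> Sup (?W j) + r_up T X * step"
  proof (rule cSup_least[OF ne(2)])
    fix y assume "y \<in> ?W (j + 1)"
    then obtain f \<tau> where "y = f (\<tau> + step)" "f \<in> X" "\<tau> \<in> {?a..?a + step}" unfolding W by blast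
    then show "y \<le> Sup (?W j) + r_up T X * step" using shift[of f \<tau>] bounds[of f \<tau>] by linarith
  qed
  then show "omega_up_inc T N X j \<le> r_up T X * step"
    by (simp add: omega_up_inc_def omega_up_def)
  have "Sup (?W j) \<le> Sup (?W (j + 1)) - r_lo T X * step"
  proof (rule cSup_least[OF ne(1)])
    fix y assume "y \<in> ?W j"
    then obtain f \<tau> where "y = f \<tau>" "f \<in> X" "\<tau> \<in> {?a..?a + step}" unfolding W by blast
    then show "y \<le> Sup (?W (j + 1)) - r_lo T X * step"
      using shift[of f \<tau>] bounds[of f \<tau>] by linarith
  qed
  then show "r_lo T X * step \<le> omega_up_inc T N X j"
    by (simp add: omega_up_inc_def omega_up_def)
  have "Inf (?W j) + r_lo T X * step \<le> Inf (?W (j + 1))"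
  proof (rule cInf_greatest[OF ne(2)])
    fix y assume "y \<in> ?W (j + 1)"
    then obtain f \<tau> where "y = f (\<tau> + step)" "f \<in> X" "\<tau> \<in> {?a..?a + step}" unfolding W by blast
    then show "Inf (?W j) + r_lo T X * step \<le> y" using shift[of f \<tau>] bounds[of f \<tau>] by linarith
  qed
  then show "r_lo T X * step \<le> omega_lo_inc T N X j"
    by (simp add: omega_lo_inc_def omega_lo_def)
  have "Inf (?W (j + 1)) - r_up T X * step \<le> Inf (?W j)"
  proof (rule cInf_greatest[OF ne(1)])
    fix y assume "y \<in> ?W j"
    then obtain f \<tau> where "y = f \<tau>" "f \<in> X" "\<tau> \<in> {?a..?a + step}" unfolding W by blast
    then show "Inf (?W (j + 1)) - r_up T X * step \<le> y"
      using shift[of f \<tau>] bounds[of f \<tau>] by linarith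
  qed
  then show "omega_lo_inc T N X j \<le> r_up T X * step"
    by (simp add: omega_lo_inc_def omega_lo_def)
qed

text \<open>
  A breakpoint is displaced from its grid point by the time a function needs to cover the
  increment of the supremum or infimum at the extreme ramp rate of the same sign. As the ramp bounds
  allow for the whole increment within one step, the displacement is at most one step.
\<close>

lemma break_near_grid:
  assumes j: "j \<in> {1..N - 2}"
  shows "\<bar>break_up T N X j - grid T N (j + 1)\<bar> \<le> step"
    and "\<bar>break_lo T N X j - grid T N (j + 1)\<bar> \<le> step"
proof -
  \<comment> \<open>A negative increment over the negative ramp bound is a quotient of positive numbers.\<close>
  have quot: "(if 0 \<le> x then x / r_up T X else x / r_lo T X) \<in> {0..step}"
    if "r_lo T X * step \<le> x" "x \<le> r_up T X * step" for x
    using that step_pos divide_in_segment[of x "r_up T X" step]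
      divide_in_segment[of "- x" "- r_lo T X" step] by auto
  show "\<bar>break_up T N X j - grid T N (j + 1)\<bar> \<le> step"
    using quot[OF window_increments(1,2)[OF j]] by (auto simp: break_up_def split: if_splits)
  show "\<bar>break_lo T N X j - grid T N (j + 1)\<bar> \<le> step"
    using quot[OF window_increments(3,4)[OF j]] by (auto simp: break_lo_def split: if_splits)
qed

lemma load_breaks_subset_horizon: "breaks_up T N X \<union> breaks_lo T N X \<subseteq> {0..T}"
proof -
  have "x \<in> {0..T}" if "j \<in> {1..N - 2}" "\<bar>x - grid T N (j + 1)\<bar> \<le> step" for j x
  proof -
    have "grid T N j \<in> {0..T}" "grid T N (j + 1 + 1) \<in> {0..T}"
      using that(1) by (intro grid_in_horizon; auto)+
    with that(2) show ?thesis
      unfolding grid_Suc[of j] grid_Suc[of "j + 1"] atLeastAtMost_iff by linarith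
  qed
  then show ?thesis
    using break_near_grid grid_in_horizon unfolding breaks_up_def breaks_lo_def by blast
qed

end

section \<open>Families of loads and their breakpoints\<close>

locale loads =
  fixes T :: real and N :: nat and \<Xi> :: "'d::finite \<Rightarrow> (real \<Rightarrow> real) set"
  assumes loads: "load T N (\<Xi> d)"
begin

lemma bundle_in_Omega:
  assumes "\<And>d. f d \<in> \<Xi> d"
  shows "(\<lambda>t\<in>{0..T}. \<chi> d. f d t) \<in> Omega T N \<Xi>"
proof -
  let ?\<xi> = "\<lambda>t\<in>{0..T}. \<chi> d. f d t"
  have "continuous_on {0..T} ?\<xi>"
    by (subst continuous_on_cong[where g = "\<lambda>t. \<chi> d. f d t"])
      (auto intro!: continuous_on_vec_lambda load.demand_continuous[OF loads assms])
  moreover have "(\<lambda>t\<in>{0..T}. ?\<xi> t $ d) = f d" for d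
  proof
    fix t
    have "f d \<in> extensional {0..T}"
      using load.demand_extensional[OF loads] assms by blast
    then show "(\<lambda>t\<in>{0..T}. ?\<xi> t $ d) t = f d t"
      by (cases "t \<in> {0..T}") (auto simp: extensional_def)
  qed
  ultimately show ?thesis
    using load.demand_subset_Omega_load[OF loads] assms
    unfolding Omega_def cont_funs_def by (auto simp del: restrict_apply)
qed

lemma breaks_subset_horizon: "breaks T N \<Xi> \<subseteq> {0..T}"
  using load.load_breaks_subset_horizon[OF loads] by (auto simp: breaks_def)

lemma finite_breaks: "finite (breaks T N \<Xi>)"
  by (simp add: breaks_def breaks_up_def breaks_lo_def)

lemma horizon_ends_in_breaks: "0 \<in> breaks T N \<Xi>" "T \<in> breaks T N \<Xi>"
proof -
  have "grid T N j \<in> breaks T N \<Xi>" if "j \<in> {1..N}" for j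
    using that by (auto simp: breaks_def breaks_up_def)
  from this[of 1] this[of N] show "0 \<in> breaks T N \<Xi>" "T \<in> breaks T N \<Xi>"
    using load.grid_1[OF loads] load.grid_N[OF loads] load.N_ge_2[OF loads] by auto
qed

lemma num_breaks_ge_2: "2 \<le> num_breaks T N \<Xi>"
proof -
  have "card {0, T} \<le> card (breaks T N \<Xi>)"
    using horizon_ends_in_breaks finite_breaks by (intro card_mono) auto
  then show ?thesis using load.T_pos[OF loads] by (simp add: num_breaks_def)
qed

lemma strict_mono_Tb: "strict_mono_on {1..num_breaks T N \<Xi>} (Tb T N \<Xi>)"
proof (rule strict_mono_onI)
  fix i j assume "i \<in> {1..num_breaks T N \<Xi>}" "j \<in> {1..num_breaks T N \<Xi>}" "i < j"
  then show "Tb T N \<Xi> i < Tb T N \<Xi> j"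
    unfolding Tb_def num_breaks_def
    by (intro sorted_wrt_nth_less[OF strict_sorted_list_of_set]) auto
qed

lemma Tb_image: "Tb T N \<Xi> ` {1..num_breaks T N \<Xi>} = breaks T N \<Xi>"
proof -
  let ?xs = "sorted_list_of_set (breaks T N \<Xi>)"
  have "Tb T N \<Xi> ` Suc ` {..<num_breaks T N \<Xi>} = (!) ?xs ` {..<length ?xs}"
    by (simp add: image_image Tb_def num_breaks_def)
  also have "\<dots> = set ?xs" by (auto simp: set_conv_nth)
  finally show ?thesis using finite_breaks by (simp add: image_Suc_lessThan)
qed

lemma Tb_ends: "Tb T N \<Xi> 1 = 0" "Tb T N \<Xi> (num_breaks T N \<Xi>) = T"
proof -
  let ?M = "num_breaks T N \<Xi>"
  have M: "1 \<in> {1..?M}" "?M \<in> {1..?M}" using num_breaks_ge_2 by auto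
  have mono: "Tb T N \<Xi> i \<le> Tb T N \<Xi> j" if "i \<in> {1..?M}" "j \<in> {1..?M}" "i \<le> j" for i j
    using that strict_mono_onD[OF strict_mono_Tb, of i j] by (cases "i = j") auto
  obtain i j where ij: "i \<in> {1..?M}" "Tb T N \<Xi> i = 0" "j \<in> {1..?M}" "Tb T N \<Xi> j = T"
    using horizon_ends_in_breaks Tb_image by (metis imageE)
  have "Tb T N \<Xi> 1 \<in> {0..T}" "Tb T N \<Xi> ?M \<in> {0..T}"
    using M Tb_image breaks_subset_horizon by blast+
  with mono[OF M(1) ij(1)] mono[OF ij(3) M(2)] ij
  show "Tb T N \<Xi> 1 = 0" "Tb T N \<Xi> ?M = T" by auto
qed

lemma ex1_Tb_cell:
  assumes "t \<in> {0..<T}"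
  shows "\<exists>!j. j \<in> {1..num_breaks T N \<Xi> - 1} \<and> t \<in> {Tb T N \<Xi> j..<Tb T N \<Xi> (j + 1)}"
  using assms num_breaks_ge_2 Tb_ends by (intro ex1_cell[OF strict_mono_Tb]) auto

lemma Tb_idx_range:
  assumes "t \<in> {0..T}"
  shows "Tb_idx T N \<Xi> t \<in> {1..num_breaks T N \<Xi> - 1}"
proof (cases "t = T")
  case True
  then show ?thesis using num_breaks_ge_2 by (auto simp: Tb_idx_def)
next
  case False
  with assms have "t \<in> {0..<T}" by auto
  from theI'[OF ex1_Tb_cell[OF this]] False show ?thesis by (simp add: Tb_idx_def)
qed

lemma Tb_idx_Tb:
  assumes "j \<in> {1..num_breaks T N \<Xi> - 1}"
  shows "Tb_idx T N \<Xi> (Tb T N \<Xi> j) = j" "Tb T N \<Xi> j \<in> {0..<T}"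
proof -
  have j: "Tb T N \<Xi> j < Tb T N \<Xi> (num_breaks T N \<Xi>)" "Tb T N \<Xi> j < Tb T N \<Xi> (j + 1)"
    using assms by (auto intro!: strict_mono_onD[OF strict_mono_Tb])
  have "Tb T N \<Xi> j \<in> breaks T N \<Xi>" using assms Tb_image by auto
  with j breaks_subset_horizon show hor: "Tb T N \<Xi> j \<in> {0..<T}" by (auto simp: Tb_ends)
  from the1_equality[OF ex1_Tb_cell[OF hor]] assms j
  show "Tb_idx T N \<Xi> (Tb T N \<Xi> j) = j" by (auto simp: Tb_idx_def Tb_ends)
qed

section \<open>Interpolation between breakpoints\<close>

definition interpolate :: "(nat \<Rightarrow> real) \<Rightarrow> real \<Rightarrow> real" where
  "interpolate b t =
     (1 - gam T N \<Xi> t) * b (Tb_idx T N \<Xi> t) + gam T N \<Xi> t * b (Tb_idx T N \<Xi> t + 1)"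

lemma interpolate_Tb:
  assumes "j \<in> {1..num_breaks T N \<Xi>}"
  shows "interpolate b (Tb T N \<Xi> j) = b j"
proof (cases "j = num_breaks T N \<Xi>")
  case True
  \<comment> \<open>The horizon end has no cell of its own: it is the right end of the last cell.\<close>
  then show ?thesis
    using num_breaks_ge_2 by (simp add: Tb_ends interpolate_def gam_def Tb_idx_def)
next
  case False
  with assms have "j \<in> {1..num_breaks T N \<Xi> - 1}" by auto
  from Tb_idx_Tb[OF this] show ?thesis by (auto simp: interpolate_def gam_def)
qed

lemma interpolate_eq_0_iff:
  "(\<forall>t\<in>{0..T}. interpolate b t = 0) \<longleftrightarrow> (\<forall>j\<in>{1..num_breaks T N \<Xi>}. b j = 0)"
proof (intro iffI ballI)
  fix j assume "\<forall>t\<in>{0..T}. interpolate b t = 0" and j: "j \<in> {1..num_breaks T N \<Xi>}"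
  moreover have "Tb T N \<Xi> j \<in> {0..T}" using j Tb_image breaks_subset_horizon by blast
  ultimately show "b j = 0" using interpolate_Tb[OF j] by metis
next
  fix t assume "\<forall>j\<in>{1..num_breaks T N \<Xi>}. b j = 0" and "t \<in> {0..T}"
  then show "interpolate b t = 0" using Tb_idx_range[of t] by (auto simp: interpolate_def)
qed

lemma sum_xhat:
  "1 \<bullet> xhat T N \<Xi> \<alpha> \<beta> \<xi> t = (1 v* \<alpha>) \<bullet> \<xi> t + interpolate (\<lambda>j. 1 \<bullet> \<beta> j) t"
  by (simp add: xhat_def interpolate_def inner_add_right dot_lmul_matrix)

end

section \<open>Power balance\<close>

theorem proposition4:
  fixes T :: real and N :: nat
    and \<Xi> :: "'d::finite \<Rightarrow> (real \<Rightarrow> real) set"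
    and \<alpha> :: "real ^ 'd ^ 'g::finite"
    and \<beta> :: "nat \<Rightarrow> real ^ 'g"
  assumes "T > 0" and "N \<ge> 2"
    and "\<And>d. \<Xi> d \<subseteq> extensional {0..T}"
    and "\<And>d. \<exists>\<xi>\<in>\<Xi> d. \<exists>\<xi>'\<in>\<Xi> d. \<xi> \<noteq> \<xi>'"
    and "\<And>d. bdd_above (ramps T (\<Xi> d))" and "\<And>d. bdd_below (ramps T (\<Xi> d))"
    and "\<And>d t. t \<in> {0..T} \<Longrightarrow> bdd_above (window_values T N (\<Xi> d) t)"
    and "\<And>d t. t \<in> {0..T} \<Longrightarrow> bdd_below (window_values T N (\<Xi> d) t)"
  shows "(\<forall>\<xi>\<in>Omega T N \<Xi>. \<forall>t\<in>{0..T}. 1 \<bullet> xhat T N \<Xi> \<alpha> \<beta> \<xi> t = 1 \<bullet> \<xi> t) \<longleftrightarrow>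
         (1 v* \<alpha> = 1 \<and> (\<forall>j\<in>{1..num_breaks T N \<Xi>}. 1 \<bullet> \<beta> j = 0))"
proof -
  interpret loads T N \<Xi>
  proof (unfold_locales)
    show "\<Xi> d \<noteq> {}" for d using assms(4)[of d] by blast
  qed (use assms in auto)
  let ?c = "1 v* \<alpha> - 1" and ?I = "interpolate (\<lambda>j. 1 \<bullet> \<beta> j)"
  have balance: "1 \<bullet> xhat T N \<Xi> \<alpha> \<beta> \<xi> t = 1 \<bullet> \<xi> t \<longleftrightarrow> ?c \<bullet> \<xi> t + ?I t = 0" for \<xi> t
    by (auto simp: sum_xhat inner_diff_left)
  have "(\<forall>\<xi>\<in>Omega T N \<Xi>. \<forall>t\<in>{0..T}. ?c \<bullet> \<xi> t + ?I t = 0)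
      \<longleftrightarrow> ?c = 0 \<and> (\<forall>t\<in>{0..T}. ?I t = 0)"
  proof
    assume bal: "\<forall>\<xi>\<in>Omega T N \<Xi>. \<forall>t\<in>{0..T}. ?c \<bullet> \<xi> t + ?I t = 0"
    obtain f where f: "f d \<in> \<Xi> d" for d using assms(4) by metis
    have bal': "?c \<bullet> (\<chi> d. g d t) + ?I t = 0" if "\<And>d. g d \<in> \<Xi> d" "t \<in> {0..T}" for g t
      using bal bundle_in_Omega[OF that(1)] that(2) by fastforce
    have "?c $ d = 0" for d
    proof -
      obtain h h' where h: "h \<in> \<Xi> d" "h' \<in> \<Xi> d" "h \<noteq> h'" using assms(4) by blast
      \<comment> \<open>Both functions are fixed outside the horizon, so they differ inside it.\<close>
      then obtain t where t: "t \<in> {0..T}" "h t \<noteq> h' t"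
        using assms(3)[of d] by (meson extensionalityI subsetD)
      have "?c \<bullet> (\<chi> e. (f(d := h)) e t) = ?c \<bullet> (\<chi> e. (f(d := h')) e t)"
      proof -
        have "(f(d := h)) e \<in> \<Xi> e" "(f(d := h')) e \<in> \<Xi> e" for e using f h by simp_all
        from bal'[OF this(1) t(1)] bal'[OF this(2) t(1)] show ?thesis by linarith
      qed
      moreover have "(\<chi> e. (f(d := h)) e t) - (\<chi> e. (f(d := h')) e t) = axis d (h t - h' t)"
        by (auto simp: vec_eq_iff axis_def)
      ultimately have "?c \<bullet> axis d (h t - h' t) = 0"
        using inner_diff_right[of ?c "\<chi> e. (f(d := h)) e t" "\<chi> e. (f(d := h')) e t"] by simp
      with t(2) show ?thesis by (simp add: inner_axis)
    qed
    then have c: "?c = 0" by (simp add: vec_eq_iff)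
    moreover have "?I t = 0" if "t \<in> {0..T}" for t
      using bal'[OF f that] by (simp only: c inner_zero_left add_0)
    ultimately show "?c = 0 \<and> (\<forall>t\<in>{0..T}. ?I t = 0)" by blast
  next
    assume "?c = 0 \<and> (\<forall>t\<in>{0..T}. ?I t = 0)"
    then show "\<forall>\<xi>\<in>Omega T N \<Xi>. \<forall>t\<in>{0..T}. ?c \<bullet> \<xi> t + ?I t = 0"
      by (simp only: inner_zero_left add_0) simp
  qed
  then show ?thesis by (simp only: balance interpolate_eq_0_iff right_minus_eq)
qed

end
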